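(* For each real number $q\in[1/\sqrt{2},1)$, the Soup Division Problem $SDP(q)$ has a boundedly fair division.
   Context: Let $0<q<1$. A sequence of signs is a sequence $( *_i)_{i\ge 1}$ with each $*_i\in\{+,-\}$; write $*_i a$ for $+a$ or $-a$ accordingly. A sequence of signs $( *_i)_{i\ge1}$ is an asymptotically fair division for $SDP(q)$ if $\sum_{i=1}^n *_i 1=o(n)$ as $n\to\infty$ and $\lim_{n\to\infty}\sum_{i=1}^n *_i q^i=0$. It is a boundedly fair division for $SDP(q)$ if it is an asymptotically fair division for $SDP(q)$ and moreover $\sum_{i=1}^n *_i 1=O(1)$ (i.e. these partial sums are bounded uniformly in $n$). *)

theory Defs
  imports Complex_Main "HOL-Library.Landau_Symbols"
begin

datatype sign = Plus_Sign | Minus_Sign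

primrec signed :: "sign \<Rightarrow> 'a::ab_group_add \<Rightarrow> 'a" where
  "signed Plus_Sign a = a"
| "signed Minus_Sign a = - a"

text \<open>
  A sequence of signs is a function \<open>s :: nat \<Rightarrow> sign\<close>; it is indexed from 1, and the value
  \<open>s 0\<close> is never used. The Soup Division Problem \<open>SDP(q)\<close> is posed for \<open>0 < q < 1\<close>; this is a
  side condition on \<open>q\<close>, not part of the definitions.
\<close>

definition asymptotically_fair_division :: "real \<Rightarrow> (nat \<Rightarrow> sign) \<Rightarrow> bool" where
  "asymptotically_fair_division q s \<longleftrightarrow>
     (\<lambda>n. \<Sum>i=1..n. signed (s i) (1::real)) \<in> o(\<lambda>n. real n) \<and>
     (\<lambda>n. \<Sum>i=1..n. signed (s i) (q ^ i)) \<longlonglongrightarrow> 0"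

definition boundedly_fair_division :: "real \<Rightarrow> (nat \<Rightarrow> sign) \<Rightarrow> bool" where
  "boundedly_fair_division q s \<longleftrightarrow>
     asymptotically_fair_division q s \<and>
     (\<lambda>n. \<Sum>i=1..n. signed (s i) (1::real)) \<in> O(\<lambda>n. 1)"

end

theory Submission
  imports Defs "HOL-Real_Asymp.Real_Asymp"
begin

text \<open>
  Divide the positions into consecutive pairs and give the two members of each pair opposite signs.
  Then the partial sums of the signs are \<open>0\<close> after each full pair and \<open>\<plusminus>1\<close> in the middle of a pair,
  so they stay bounded whatever choice is made in each pair. The pair at positions \<open>2k+1, 2k+2\<close>
  contributes \<open>\<plusminus>(q\<^bsup>2k+1\<^esup> - q\<^bsup>2k+2\<^esup>) = \<plusminus>q(1-q)r\<^sup>k\<close> with \<open>r = q\<^sup>2\<close>, and the free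
  choices left are the signs of a geometric sequence of ratio \<open>r\<close>. The hypothesis
  \<open>q \<ge> 1/\<surd>2\<close> says exactly that \<open>r \<ge> 1/2\<close>, and for such \<open>r\<close> each term is at most the
  sum of all later ones; hence the greedy choice, always stepping towards \<open>0\<close>, leaves a partial sum
  that the remaining terms can still cancel (lemma \<open>greedy_sum_bound\<close>), and so the
  sums tend to \<open>0\<close>.
\<close>

primrec greedy_sum :: "real \<Rightarrow> nat \<Rightarrow> real" where
  "greedy_sum r 0 = 0"
| "greedy_sum r (Suc k) = greedy_sum r k + (if greedy_sum r k \<le> 0 then r ^ k else - (r ^ k))"

text \<open>
  The bound is the sum of the terms \<open>r\<^sup>k, r\<^bsup>k+1\<^esup>, \<dots>\<close> not yet used. A step towards \<open>0\<close> that does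
  not cross \<open>0\<close> takes \<open>r\<^sup>k\<close> off both sides; one that does cross lands within \<open>r\<^sup>k\<close> of \<open>0\<close>, which
  is at most the new bound \<open>r\<^bsup>k+1\<^esup>/(1-r)\<close> because \<open>r \<ge> 1/2\<close>.
\<close>

lemma greedy_sum_bound:
  fixes r :: real
  assumes "1 / 2 \<le> r" and "r < 1"
  shows "\<bar>greedy_sum r k\<bar> \<le> r ^ k / (1 - r)"
proof (induction k)
  case 0
  show ?case using assms by simp
next
  case (Suc k)
  have pos: "0 < r ^ k" using assms by simp
  have split_tail: "r ^ k / (1 - r) = r ^ k + r ^ Suc k / (1 - r)"
    using assms by (simp add: field_simps)
  have "r ^ k * (1 - r) \<le> r ^ k * r"
    using assms pos by (intro mult_left_mono) auto
  then have "r ^ k \<le> r ^ Suc k / (1 - r)"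
    using assms by (simp add: field_simps)
  then show ?case using Suc.IH split_tail pos unfolding greedy_sum.simps by (simp only: split: if_split) linarith
qed

text \<open>
  The pair number \<open>k\<close> occupies the positions \<open>2k+1\<close> and \<open>2k+2\<close>, because signs are indexed from \<open>1\<close>. The
  parity of \<open>i\<close> makes the sign at the odd position agree with the step of the greedy sum and the sign
  at the even position opposite to it.
\<close>

definition paired_signs :: "real \<Rightarrow> nat \<Rightarrow> sign" where
  "paired_signs q i =
     (if (greedy_sum (q\<^sup>2) ((i - 1) div 2) \<le> 0) = odd i then Plus_Sign else Minus_Sign)"

lemma paired_sum_even:
  "(\<Sum>i=1..2 * k. signed (paired_signs q i) (q ^ i)) = q * (1 - q) * greedy_sum (q\<^sup>2) k"
proof (induction k)
  case 0
  show ?case by simp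
next
  case (Suc k)
  then show ?case
    by (simp add: paired_signs_def algebra_simps power_mult power2_eq_square)
qed

lemma abs_signed [simp]: "\<bar>signed s a\<bar> = \<bar>a\<bar>" for a :: real
  by (cases s) auto

lemma paired_count_even: "(\<Sum>i=1..2 * k. signed (paired_signs q i) (1::real)) = 0"
  by (induction k) (auto simp: paired_signs_def)

lemma paired_count_bound: "\<bar>\<Sum>i=1..n. signed (paired_signs q i) (1::real)\<bar> \<le> 1"
proof (cases "even n")
  case True
  then show ?thesis using paired_count_even by (metis abs_zero dvdE zero_le_one)
next
  case False
  then obtain k where "n = Suc (2 * k)" by (metis oddE Suc_eq_plus1)
  then show ?thesis using paired_count_even[of q k] by simp
qed

text \<open>
  After \<open>k\<close> full pairs the tail bound reads \<open>q(1-q)q\<^bsup>2k\<^esup>/(1-q\<^sup>2) = q\<^bsup>2k+1\<^esup>/(1+q)\<close>, and a half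
  pair adds at most one more term \<open>q\<^bsup>2k+1\<^esup>\<close>.
\<close>

lemma paired_sum_bound:
  fixes q :: real
  assumes "1 / 2 \<le> q\<^sup>2" and "0 < q" and "q < 1"
  shows "\<bar>\<Sum>i=1..n. signed (paired_signs q i) (q ^ i)\<bar> \<le> 2 * q ^ n"
proof -
  have "q\<^sup>2 < 1" using assms by (simp add: power_less_one_iff)
  have even_bound: "\<bar>\<Sum>i=1..2 * k. signed (paired_signs q i) (q ^ i)\<bar> \<le> q ^ Suc (2 * k)" for k
  proof -
    have "\<bar>q * (1 - q) * greedy_sum (q\<^sup>2) k\<bar> \<le> q * (1 - q) * ((q\<^sup>2) ^ k / (1 - q\<^sup>2))"
      unfolding abs_mult
      using greedy_sum_bound[OF assms(1) \<open>q\<^sup>2 < 1\<close>, of k] assms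
      by (intro mult_mono) auto
    also have "\<dots> = q ^ Suc (2 * k) / (1 + q)"
    proof -
      have "1 - q\<^sup>2 = (1 - q) * (1 + q)" by (simp add: power2_eq_square algebra_simps)
      then show ?thesis using assms by (simp add: power_mult)
    qed
    also have "\<dots> \<le> q ^ Suc (2 * k)"
      using assms by (simp add: field_simps)
    finally show ?thesis by (simp only: paired_sum_even)
  qed
  show ?thesis
  proof (cases "even n")
    case True
    then obtain k where n: "n = 2 * k" by (elim dvdE)
    have "q ^ Suc (2 * k) \<le> 2 * q ^ (2 * k)"
      using assms by (simp add: mult_right_mono)
    then show ?thesis using even_bound[of k] unfolding n by linarith
  next
    case False
    then obtain k where n: "n = Suc (2 * k)" by (metis oddE Suc_eq_plus1)
    then have "(\<Sum>i=1..n. signed (paired_signs q i) (q ^ i)) =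
        (\<Sum>i=1..2 * k. signed (paired_signs q i) (q ^ i)) + signed (paired_signs q n) (q ^ n)"
      by simp
    moreover have "\<bar>signed (paired_signs q n) (q ^ n)\<bar> = q ^ n" using assms by simp
    ultimately show ?thesis
      using even_bound[of k] unfolding n by linarith
  qed
qed

theorem proposition4:
  fixes q :: real
  assumes "1 / sqrt 2 \<le> q" and "q < 1"
  shows "\<exists>s. boundedly_fair_division q s"
proof -
  have "0 < q" using assms(1) by (rule less_le_trans[rotated]) simp
  have "(1 / sqrt 2)\<^sup>2 \<le> q\<^sup>2" using assms by (intro power_mono) auto
  then have half: "1 / 2 \<le> q\<^sup>2" by (simp add: power_divide)
  let ?c = "\<lambda>n. \<Sum>i=1..n. signed (paired_signs q i) (1::real)"
  have bounded: "?c \<in> O(\<lambda>n. 1)"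
    using paired_count_bound by (intro bigoI[where c = 1]) auto
  moreover have "(\<lambda>n. 1 :: real) \<in> o(\<lambda>n. real n)" by real_asymp
  ultimately have fair: "?c \<in> o(\<lambda>n. real n)" by (rule landau_o.big_small_trans)
  have "(\<lambda>n. q ^ n) \<longlonglongrightarrow> 0"
    using \<open>0 < q\<close> assms(2) by (intro LIMSEQ_power_zero) simp
  then have "(\<lambda>n. \<Sum>i=1..n. signed (paired_signs q i) (q ^ i)) \<longlonglongrightarrow> 0"
    by (rule tendsto_0_le[where K = 2])
       (use paired_sum_bound[OF half \<open>0 < q\<close> assms(2)] \<open>0 < q\<close> in \<open>auto simp: mult.commute\<close>)
  with bounded fair show ?thesis
    unfolding boundedly_fair_division_def asymptotically_fair_division_def by blast
qed

end
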